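(* Let $S$ be a set of sorts and let $A$ and $B$ be $S$-sorted sets such that $S_B \subseteq S_A$. Let $\mathcal{M}_1 := \operatorname{mPol} Q_A$ and $\mathcal{M}_2 := \operatorname{mPol} Q_B$ for $Q_A \subseteq \operatorname{Relp}(A)$ and $Q_B \subseteq \operatorname{Relp}(B)$. (a) The following conditions are equivalent. (i) $\mathcal{M}_2 \in \mathsf{E}\mathsf{R}\mathsf{P}\,\mathcal{M}_1$. (ii) There exists a minion homomorphism $\lambda \colon \mathcal{M}_1 \to \mathcal{M}_2$. (b) Assume that the components $A_s$ and $B_s$ of $A$ and $B$ are all finite. Then the following conditions are equivalent. (i) $\mathcal{M}_2 \in \mathsf{E}\mathsf{R}\mathsf{P}_{\mathrm{fin}}\,\mathcal{M}_1$. (ii) There exist an integer $k \geq 1$ and a reflection $(h,h')$ of $A^k$ into $B$ such that $\flat_k\bigl(Q_B^{(h,h')}\bigr) \subseteq [Q_A]$.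
   Context: Sorted sets and operations. An $S$-sorted set is a family $A=(A_s)_{s\in S}$ of sets; powers are componentwise: $A^I=(A_s^I)_{s\in S}$, and $A^k=(A_s^k)_{s \in S}$ for $k\in\mathbb N=\{0,1,2,\dots\}$. $S_A:=\{s\in S: A_s\ne\emptyset\}$. $W(S)$ is the set of finite words over $S$, including the empty word $\varepsilon$. For $w=s_1\dots s_n\in W(S)$, $A_w:=A_{s_1}\times\dots\times A_{s_n}$ (so $A_\varepsilon=\{\emptyset\}$). A declaration is a pair $(w,s)\in W(S)\times S$; it is reasonable in $A$ if $A_w\ne\emptyset$ implies $A_s\neq\emptyset$. An $S$-sorted operation on $A$ of declaration $(w,s)$ is a function $f\colon A_w\to A_s$. $\operatorname{Op}(A)$ is the set of all $S$-sorted operations on $A$. Minors and minions. For $f\colon A_w\to A_s$ with $w=s_1\dots s_n$, a word $u=u_1\dots u_m$ and a map $\sigma\colon\{1,\dots,n\}\to\{1,\dots,m\}$ with $s_i=u_{\sigma(i)}$ for all $i$, the minor $f^u_\sigma\colon A_u\to A_s$ is $f^u_\sigma(a_1,\dots,a_m):=f(a_{\sigma(1)},\dots,a_{\sigma(n)})$. A minion is a set $F\subseteq\operatorname{Op}(A)$ containing all minors of its members. A minion homomorphism between minions $\mathcal M_1\subseteq\operatorname{Op}(A)$, $\mathcal M_2\subseteq\operatorname{Op}(B)$ is a map $\lambda\colon\mathcal M_1\to\mathcal M_2$ such that $\lambda f$ has the same declaration as $f$ and $(\lambda f)^u_\sigma=\lambda(f^u_\sigma)$ for every $f\in\mathcal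 M_1$ and every minor $f^u_\sigma$. Reflections of operations. A reflection of $A$ into $B$ is a pair $(h,h')$ of families $h=(h_s)_{s\in S_B}$, $h'=(h'_s)_{s\in S_B}$ of maps $h_s\colon B_s\to A_s$, $h'_s\colon A_s\to B_s$ (it exists iff $S_B\subseteq S_A$). For $f\colon A_w\to A_s$ whose declaration is reasonable in $B$, the operation $f_{(h,h')}\colon B_w\to B_s$ is the empty map if $B_w=\emptyset$, and otherwise $f_{(h,h')}(b_1,\dots,b_n):=h'_s(f(h_{s_1}(b_1),\dots,h_{s_n}(b_n)))$. For $F\subseteq\operatorname{Op}(A)$, if the declarations of all $f\in F$ are reasonable in $B$, then $F_{(h,h')}:=\{f_{(h,h')}: f\in F\}$; such a set is called a reflection of $F$. Powers, extensions and operators. For a set $I$ and $f\in\operatorname{Op}(A)$, $f^{\otimes I}\in\operatorname{Op}(A^I)$ is the componentwise application of $f$; $F^{\otimes I}:=\{f^{\otimes I}: f\in F\}$, and $F^{\otimes k}:=F^{\otimes\{1,\dots,k\}}$. $\mathsf P F$ is the collection of all $F^{\otimes I}$ ($I$ any set), $\mathsf P_{\mathrm{fin}}F:=\{F^{\otimes k}: k\in\mathbb N\}$. For a collection $\mathcal F$ of sets of operations, $\mathsf R\mathcal F$ is the collection of all reflections of members of $\mathcal F$, and $\mathsf E\mathcal F$ is the collection of all extensions of members of $\mathcal F$, where an extension of $F\subseteq\operatorname{Op}(C)$ is any $F'\subseteq\operatorname{Op}(C)$ with $F\subseteq F'$. Relation pairs. An $m$-ary ($m\in\mathbb N$) $S$-sorted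 relation on $A$ is a family $R=(R_s)_{s\in S}$ with $R_s\subseteq A_s^m$ (for $m=0$ each $R_s$ is $\emptyset$ or $\{\emptyset\}$). An $m$-ary relation pair on $A$ is a pair $(R,R')$ of $m$-ary $S$-sorted relations; $\operatorname{Relp}(A)$ is the set of all relation pairs of all arities. An operation $f\colon A_w\to A_s$, $w=s_1\dots s_n$, preserves $(R,R')$ if for all $m$-tuples $r_i\in R_{s_i}$ ($i=1,\dots,n$) the $m$-tuple obtained by applying $f$ coordinatewise to $r_1,\dots,r_n$ is in $R'_s$. $\operatorname{mPol}Q$ is the set of all $f\in\operatorname{Op}(A)$ preserving all pairs in $Q$; $\operatorname{mInv}F$ is the set of all relation pairs preserved by all $f\in F$. For $A$ with finite components and $Q\subseteq\operatorname{Relp}(A)$, $[Q]=\operatorname{mInv}\operatorname{mPol}Q$ is the minor-closure of $Q$. Coreflections of relation pairs. Let $(h,h')$ be a reflection of $A$ into $B$. For an $m$-ary $(T,T')\in\operatorname{Relp}(B)$, $(T,T')^{(h,h')}:=(R,R')\in\operatorname{Relp}(A)$, where for $B_s\neq\emptyset$, $R_s=\{(h_s(b_1),\dots,h_s(b_m)):(b_1,\dots,b_m)\in T_s\}$ and $R'_s=\{(a_1,\dots,a_m)\in A_s^m:(h'_s(a_1),\dots,h'_s(a_m))\in T'_s\}$; for $B_s=\emptyset$, $R_s=R'_s=\emptyset$ (for every arity $m$). For sets of pairs, $Q^{(h,h')}$ is defined elementwise. In (b), $(h,h')$ is a reflection of $A^k$ into $B$, so $A^k$ takes the role of $A$. Flattening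 ($k\ge1$). $\flat_k$ turns an $n$-tuple of $k$-tuples over $A_s$ into the tuple of length $nk$ over $A_s$ obtained by concatenation. It is applied elementwise and sortwise to relations and relation pairs on $A^k$; for $T\subseteq\operatorname{Relp}(A^k)$, $\flat_kT:=\{\flat_k(R,R'):(R,R')\in T\}\subseteq\operatorname{Relp}(A)$.
   Formalization: In (b), (ii)⇒(i) fails as printed if some B_s is empty; it is proved assuming each declaration of a member of M_1 that mentions a sort t with B_t empty is also the declaration of a member of M_2 (automatic if all B_s are nonempty, implied by (i)). (i)⇒(ii) is unconditional. *)

theory Defs
  imports Main "HOL-Library.FuncSet"
begin

text \<open>
  An S-sorted set is a function \<open>A :: 's \<Rightarrow> 'a set\<close>, of which only the values at the sorts in
  \<open>S :: 's set\<close> matter. Words over \<open>S\<close> are the members of \<open>lists S\<close>. An operation carries its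
  declaration, because the empty map does not determine it; the underlying map is extensional, so
  that equality of operations is equality of maps on \<open>A\<^sub>w\<close>.
\<close>

type_synonym ('s, 'a) sop = "'s list \<times> 's \<times> ('a list \<Rightarrow> 'a)"

definition supp :: "'s set \<Rightarrow> ('s \<Rightarrow> 'a set) \<Rightarrow> 's set" where
  "supp S A = {s \<in> S. A s \<noteq> {}}"

definition wprod :: "('s \<Rightarrow> 'a set) \<Rightarrow> 's list \<Rightarrow> 'a list set" where
  "wprod A w = listset (map A w)"

definition reasonable :: "('s \<Rightarrow> 'a set) \<Rightarrow> 's list \<Rightarrow> 's \<Rightarrow> bool" where
  "reasonable A w s \<longleftrightarrow> (wprod A w \<noteq> {} \<longrightarrow> A s \<noteq> {})"

definition Op :: "'s set \<Rightarrow> ('s \<Rightarrow> 'a set) \<Rightarrow> ('s, 'a) sop set" where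
  "Op S A = {(w, s, f). w \<in> lists S \<and> s \<in> S \<and> f \<in> wprod A w \<rightarrow>\<^sub>E A s}"

fun decl :: "('s, 'a) sop \<Rightarrow> 's list \<times> 's" where
  "decl (w, s, f) = (w, s)"


section \<open>Minors and minions\<close>

text \<open>Words and tuples are indexed from 0, and only the values of \<open>\<sigma>\<close> below \<open>length w\<close> matter.\<close>

definition minor_map :: "'s set \<Rightarrow> 's list \<Rightarrow> 's list \<Rightarrow> (nat \<Rightarrow> nat) \<Rightarrow> bool" where
  "minor_map S w u \<sigma> \<longleftrightarrow> u \<in> lists S \<and> (\<forall>i < length w. \<sigma> i < length u \<and> w ! i = u ! \<sigma> i)"

fun minor :: "('s \<Rightarrow> 'a set) \<Rightarrow> 's list \<Rightarrow> (nat \<Rightarrow> nat) \<Rightarrow> ('s, 'a) sop \<Rightarrow> ('s, 'a) sop" where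
  "minor A u \<sigma> (w, s, f) = (u, s, \<lambda>a \<in> wprod A u. f (map (\<lambda>i. a ! \<sigma> i) [0..<length w]))"

definition minion :: "'s set \<Rightarrow> ('s \<Rightarrow> 'a set) \<Rightarrow> ('s, 'a) sop set \<Rightarrow> bool" where
  "minion S A F \<longleftrightarrow> F \<subseteq> Op S A \<and>
     (\<forall>f \<in> F. \<forall>u \<sigma>. minor_map S (fst (decl f)) u \<sigma> \<longrightarrow> minor A u \<sigma> f \<in> F)"

definition minion_hom :: "'s set \<Rightarrow> ('s \<Rightarrow> 'a set) \<Rightarrow> ('s, 'a) sop set \<Rightarrow>
    ('s \<Rightarrow> 'b set) \<Rightarrow> ('s, 'b) sop set \<Rightarrow> (('s, 'a) sop \<Rightarrow> ('s, 'b) sop) \<Rightarrow> bool" where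
  "minion_hom S A M1 B M2 l \<longleftrightarrow> minion S A M1 \<and> minion S B M2 \<and> l \<in> M1 \<rightarrow> M2 \<and>
     (\<forall>f \<in> M1. decl (l f) = decl f) \<and>
     (\<forall>f \<in> M1. \<forall>u \<sigma>. minor_map S (fst (decl f)) u \<sigma> \<longrightarrow>
        minor B u \<sigma> (l f) = l (minor A u \<sigma> f))"


section \<open>Reflections, powers and the operators on collections of sets of operations\<close>

text \<open>Only the components of \<open>h\<close> and \<open>h'\<close> at the sorts in \<open>supp S B\<close> matter.\<close>

definition reflection :: "'s set \<Rightarrow> ('s \<Rightarrow> 'a set) \<Rightarrow> ('s \<Rightarrow> 'b set) \<Rightarrow>
    ('s \<Rightarrow> 'b \<Rightarrow> 'a) \<Rightarrow> ('s \<Rightarrow> 'a \<Rightarrow> 'b) \<Rightarrow> bool" where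
  "reflection S A B h h' \<longleftrightarrow> (\<forall>s \<in> supp S B. h s \<in> B s \<rightarrow> A s \<and> h' s \<in> A s \<rightarrow> B s)"

fun reflect_op :: "('s \<Rightarrow> 'b set) \<Rightarrow> ('s \<Rightarrow> 'b \<Rightarrow> 'a) \<Rightarrow> ('s \<Rightarrow> 'a \<Rightarrow> 'b) \<Rightarrow>
    ('s, 'a) sop \<Rightarrow> ('s, 'b) sop" where
  "reflect_op B h h' (w, s, f) = (w, s, \<lambda>b \<in> wprod B w. h' s (f (map2 h w b)))"

definition spow :: "('s \<Rightarrow> 'a set) \<Rightarrow> 'i set \<Rightarrow> 's \<Rightarrow> ('i \<Rightarrow> 'a) set" where
  "spow A I = (\<lambda>s. I \<rightarrow>\<^sub>E A s)"

fun opow :: "('s \<Rightarrow> 'a set) \<Rightarrow> 'i set \<Rightarrow> ('s, 'a) sop \<Rightarrow> ('s, 'i \<Rightarrow> 'a) sop" where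
  "opow A I (w, s, f) =
     (w, s, \<lambda>x \<in> wprod (spow A I) w. \<lambda>i \<in> I. f (map (\<lambda>g. g i) x))"

text \<open>
  A collection of sets of operations consists of pairs \<open>(C, F)\<close> with \<open>F \<subseteq> Op S C\<close>: the sorted
  set \<open>C\<close> is recorded because \<open>F\<close> need not determine it.

  The index sets in \<open>powers\<close> are all subsets of an arbitrary type \<open>'i\<close>, since a single HOL formula
  cannot quantify over the sets of all types. With \<open>'i + ('s \<Rightarrow> 'b \<Rightarrow> 'a)\<close> in place of \<open>'i\<close>, for arbitrary
  \<open>'i\<close>, every index set is covered (a power depends on \<open>I\<close> only up to bijection), and there always are
  index sets as large as the families \<open>(B\<^sub>s \<Rightarrow> A\<^sub>s)\<^bsub>s \<in> S\<^esub>\<close>, from which free constructions are made.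
\<close>

type_synonym ('s, 'a) coll = "(('s \<Rightarrow> 'a set) \<times> ('s, 'a) sop set) set"

definition powers :: "'i itself \<Rightarrow> ('s \<Rightarrow> 'a set) \<Rightarrow> ('s, 'a) sop set \<Rightarrow> ('s, 'i \<Rightarrow> 'a) coll" where
  "powers _ A F = {(spow A I, opow A I ` F) | I :: 'i set. True}"

definition fin_powers :: "('s \<Rightarrow> 'a set) \<Rightarrow> ('s, 'a) sop set \<Rightarrow> ('s, nat \<Rightarrow> 'a) coll" where
  "fin_powers A F = {(spow A {1..k}, opow A {1..k} ` F) | k :: nat. True}"

definition reflections :: "'s set \<Rightarrow> ('s, 'a) coll \<Rightarrow> ('s, 'b) coll" where
  "reflections S \<F> = {(B, reflect_op B h h' ` F) | B h h' A F.
     (A, F) \<in> \<F> \<and> reflection S A B h h' \<and> (\<forall>(w, s, f) \<in> F. reasonable B w s)}"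

definition extensions :: "'s set \<Rightarrow> ('s, 'a) coll \<Rightarrow> ('s, 'a) coll" where
  "extensions S \<F> = {(C, F') | C F F'. (C, F) \<in> \<F> \<and> F \<subseteq> F' \<and> F' \<subseteq> Op S C}"


section \<open>Relation pairs\<close>

text \<open>A pair \<open>(R, R')\<close> is stored with its arity; relations are empty at the indices outside \<open>S\<close>.\<close>

type_synonym ('s, 'a) rpair = "nat \<times> ('s \<Rightarrow> 'a list set) \<times> ('s \<Rightarrow> 'a list set)"

definition tuples :: "nat \<Rightarrow> 'a set \<Rightarrow> 'a list set" where
  "tuples m X = {xs. length xs = m \<and> set xs \<subseteq> X}"

definition srel :: "'s set \<Rightarrow> ('s \<Rightarrow> 'a set) \<Rightarrow> nat \<Rightarrow> ('s \<Rightarrow> 'a list set) \<Rightarrow> bool" where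
  "srel S A m R \<longleftrightarrow> (\<forall>s \<in> S. R s \<subseteq> tuples m (A s)) \<and> (\<forall>s. s \<notin> S \<longrightarrow> R s = {})"

definition Relp :: "'s set \<Rightarrow> ('s \<Rightarrow> 'a set) \<Rightarrow> ('s, 'a) rpair set" where
  "Relp S A = {(m, R, R'). srel S A m R \<and> srel S A m R'}"

fun preserves :: "('s, 'a) sop \<Rightarrow> ('s, 'a) rpair \<Rightarrow> bool" where
  "preserves (w, s, f) (m, R, R') \<longleftrightarrow>
     (\<forall>rs \<in> wprod R w. map (\<lambda>j. f (map (\<lambda>r. r ! j) rs)) [0..<m] \<in> R' s)"

definition mPol :: "'s set \<Rightarrow> ('s \<Rightarrow> 'a set) \<Rightarrow> ('s, 'a) rpair set \<Rightarrow> ('s, 'a) sop set" where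
  "mPol S A Q = {f \<in> Op S A. \<forall>q \<in> Q. preserves f q}"

definition mInv :: "'s set \<Rightarrow> ('s \<Rightarrow> 'a set) \<Rightarrow> ('s, 'a) sop set \<Rightarrow> ('s, 'a) rpair set" where
  "mInv S A F = {q \<in> Relp S A. \<forall>f \<in> F. preserves f q}"

definition minor_closure :: "'s set \<Rightarrow> ('s \<Rightarrow> 'a set) \<Rightarrow> ('s, 'a) rpair set \<Rightarrow> ('s, 'a) rpair set" where
  "minor_closure S A Q = mInv S A (mPol S A Q)"

fun coreflect :: "'s set \<Rightarrow> ('s \<Rightarrow> 'a set) \<Rightarrow> ('s \<Rightarrow> 'b set) \<Rightarrow>
    ('s \<Rightarrow> 'b \<Rightarrow> 'a) \<Rightarrow> ('s \<Rightarrow> 'a \<Rightarrow> 'b) \<Rightarrow> ('s, 'b) rpair \<Rightarrow> ('s, 'a) rpair" where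
  "coreflect S A B h h' (m, T, T') =
     (m, (\<lambda>s. if s \<in> supp S B then map (h s) ` T s else {}),
         (\<lambda>s. if s \<in> supp S B then {a \<in> tuples m (A s). map (h' s) a \<in> T' s} else {}))"

definition flat_tuple :: "nat \<Rightarrow> (nat \<Rightarrow> 'a) list \<Rightarrow> 'a list" where
  "flat_tuple k xs = concat (map (\<lambda>x. map x [1..<Suc k]) xs)"

fun flat :: "nat \<Rightarrow> ('s, nat \<Rightarrow> 'a) rpair \<Rightarrow> ('s, 'a) rpair" where
  "flat k (m, R, R') = (m * k, (\<lambda>s. flat_tuple k ` R s), (\<lambda>s. flat_tuple k ` R' s))"


section \<open>Declarations that involve an empty component of the target\<close>

text \<open>
  Suppose that \<open>flat\<^sub>k (Q\<^sub>B\<^bsup>(h,h')\<^esup>) \<subseteq> [Q\<^sub>A]\<close>. When some component of \<open>B\<close> is empty, this alone does not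
  imply that \<open>mPol Q\<^sub>B\<close> extends a reflection of a finite power of \<open>mPol Q\<^sub>A\<close>, since coreflected pairs
  do not see the empty components of \<open>B\<close>:

  \<^item> Two sorts, \<open>A\<^sub>1 = A\<^sub>2 = B\<^sub>1\<close> a singleton, \<open>B\<^sub>2\<close> empty, \<open>Q\<^sub>A\<close> and \<open>Q\<^sub>B\<close> empty. The inclusion is
    vacuous, but \<open>Op A\<close> has an operation of declaration \<open>(1, 2)\<close>, which is not reasonable in \<open>B\<close>, so
    no power of \<open>Op A\<close> has a reflection on \<open>B\<close>.

  \<^item> One sort, \<open>A = {0, 1}\<close>, \<open>mPol Q\<^sub>A\<close> the idempotent operations, \<open>B\<close> empty, \<open>Q\<^sub>B\<close> a single 0-ary pair
    \<open>(T, T')\<close> with \<open>T\<close> full and \<open>T'\<close> empty. No empty map preserves \<open>(T, T')\<close>, so \<open>mPol Q\<^sub>B\<close> is empty, but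
    the coreflection of \<open>(T, T')\<close> consists of empty relations.

  The condition below excludes exactly this. It holds trivially if all components of \<open>B\<close> are
  nonempty, and it is necessary for \<open>M2\<close> to extend a reflection of a power of \<open>M1\<close> (reflections
  and powers keep the declarations).
\<close>

definition empty_sorts_compatible ::
    "('s \<Rightarrow> 'b set) \<Rightarrow> ('s, 'a) sop set \<Rightarrow> ('s, 'b) sop set \<Rightarrow> bool" where
  "empty_sorts_compatible B M1 M2 \<longleftrightarrow>
     (\<forall>(w, s, f) \<in> M1. (\<exists>t \<in> insert s (set w). B t = {}) \<longrightarrow> (\<exists>g. (w, s, g) \<in> M2))"

end

theory Submission
  imports Defs
begin

text \<open>
  Minors rearrange the arguments of an operation, while powers and reflections act on the values of
  the arguments and of the result. The two kinds of construction therefore commute, and a reflection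
  of a power \<open>f \<mapsto> (f\<^bsup>\<otimes>I\<^esup>)\<^bsub>(h,h')\<^esub>\<close> with values in \<open>M2\<close> is a minion homomorphism. This is one
  direction of the first equivalence (\<open>minion_hom_if_power_reflects_into\<close>).

  Conversely, a homomorphism \<open>\<lambda>\<close> is realized by the power whose index set consists of all sorted
  maps \<open>\<phi>\<close> from \<open>B\<close> to \<open>A\<close>. Let \<open>h b\<close> be the evaluation \<open>\<phi> \<mapsto> \<phi> b\<close>; the elements \<open>h b\<close> behave like free
  generators, since the values of \<open>\<phi>\<close> can be prescribed arbitrarily. There is only one choice for
  \<open>h'\<close> on the elements generated by them: \<open>h'\<close> must send \<open>f\<^bsup>\<otimes>I\<^esup>(h b\<^sub>1, \<dots>, h b\<^sub>n)\<close> to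
  \<open>(\<lambda> f)(b\<^sub>1, \<dots>, b\<^sub>n)\<close>. It is well defined: if \<open>f\<close> at \<open>b\<close> and \<open>f'\<close> at \<open>b'\<close> generate the same element,
  then the minors of \<open>f\<close> and \<open>f'\<close> in which arguments are identified whenever their sorts and the
  entries of \<open>b\<close>, \<open>b'\<close> agree coincide, and \<open>\<lambda>\<close> commutes with these minors (\<open>hom_value_determined\<close>).

  The second equivalence rests on two Galois-type identities: \<open>f\<close> preserves a flattened pair iff
  \<open>f\<^bsup>\<otimes>k\<^esup>\<close> preserves the pair (\<open>preserves_flat_iff\<close>), and \<open>f\<close> preserves a coreflected pair iff the
  reflection of \<open>f\<close> preserves the pair (\<open>preserves_coreflect_iff\<close>). Together they say that the
  flattened coreflections of \<open>QB\<close> are invariants of \<open>M1\<close> iff the reflected powers of the members of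
  \<open>M1\<close> are polymorphisms of \<open>QB\<close>, provided that no empty component of \<open>B\<close> occurs in the
  declarations. An operation with an empty component among its arguments preserves every
  coreflected pair vacuously, which is harmless from left to right in the second equivalence; in the
  other direction \<open>empty_sorts_compatible\<close> settles such declarations. Finally \<open>k = 0\<close> can be
  replaced by \<open>k = 1\<close>, as the reflections of the 0-th power are constant.
\<close>

section \<open>Tuples sorted by a word\<close>

lemma in_listset_iff:
  "xs \<in> listset As \<longleftrightarrow> length xs = length As \<and> (\<forall>i < length As. xs ! i \<in> As ! i)"
proof (induction As arbitrary: xs)
  case (Cons C As)
  then show ?case
    by (cases xs) (auto simp: set_Cons_def nth_Cons split: nat.splits)
qed auto

lemma in_wprod_iff:
  "xs \<in> wprod A w \<longleftrightarrow> length xs = length w \<and> (\<forall>i < length w. xs ! i \<in> A (w ! i))"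
  by (auto simp: wprod_def in_listset_iff)

lemma wprod_eq_empty_iff: "wprod A w = {} \<longleftrightarrow> (\<exists>t \<in> set w. A t = {})"
  unfolding wprod_def by (induction w) (auto simp: set_Cons_def)

lemma wprod_map2:
  assumes "xs \<in> wprod R w" and "\<And>t x. t \<in> set w \<Longrightarrow> x \<in> R t \<Longrightarrow> g t x \<in> R' t"
  shows "map2 g w xs \<in> wprod R' w"
  using assms by (auto simp: in_wprod_iff)

lemma in_Op_iff:
  "(w, s, f) \<in> Op S A \<longleftrightarrow> w \<in> lists S \<and> s \<in> S \<and> f \<in> extensional (wprod A w) \<and>
     (\<forall>a \<in> wprod A w. f a \<in> A s)"
  by (auto simp: Op_def PiE_def)

text \<open>
  Reflections are controlled only on the nonempty components of \<open>B\<close>, so this is what allows them to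
  be applied to the entries of a tuple.
\<close>

lemma set_word_subset_supp:
  assumes "w \<in> lists S" "b \<in> wprod B w"
  shows "set w \<subseteq> supp S B"
  using assms wprod_eq_empty_iff[of B w] by (auto simp: supp_def)

lemma minor_map_wprod:
  assumes "minor_map S w u \<sigma>" "a \<in> wprod A u"
  shows "map (\<lambda>i. a ! \<sigma> i) [0..<length w] \<in> wprod A w"
  using assms by (auto simp: minor_map_def in_wprod_iff)

section \<open>Minors of polymorphisms, powers and reflections\<close>

lemma minor_in_Op:
  assumes "(w, s, f) \<in> Op S A" "minor_map S w u \<sigma>"
  shows "minor A u \<sigma> (w, s, f) \<in> Op S A"
  using assms minor_map_wprod[OF assms(2), of _ A] by (auto simp: in_Op_iff minor_map_def)

text \<open>
  Rearranging and repeating the columns of a matrix with columns in \<open>R\<close> gives such a matrix again.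
  The pair must be one on \<open>A\<close> because a minor is extensional: the rows of the matrix have to lie in
  the domain of the minor.
\<close>

lemma preserves_minor:
  assumes q: "(m, R, R') \<in> Relp S A"
    and pres: "preserves (w, s, f) (m, R, R')"
    and mm: "minor_map S w u \<sigma>"
  shows "preserves (minor A u \<sigma> (w, s, f)) (m, R, R')"
proof -
  have "map (\<lambda>j. (\<lambda>a \<in> wprod A u. f (map (\<lambda>i. a ! \<sigma> i) [0..<length w]))
          (map (\<lambda>r. r ! j) rs)) [0..<m] \<in> R' s" if rs: "rs \<in> wprod R u" for rs
  proof -
    let ?rs = "map (\<lambda>i. rs ! \<sigma> i) [0..<length w]"
    have u: "set u \<subseteq> S"
      using mm by (auto simp: minor_map_def)
    have col: "map (\<lambda>r. r ! j) rs \<in> wprod A u" if "j < m" for j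
      unfolding in_wprod_iff
    proof (intro conjI allI impI)
      show "length (map (\<lambda>r. r ! j) rs) = length u"
        using rs by (simp add: in_wprod_iff)
      fix i assume i: "i < length u"
      then have "rs ! i \<in> R (u ! i)" "u ! i \<in> S" "i < length rs"
        using rs u by (auto simp: in_wprod_iff)
      moreover from this have "rs ! i \<in> tuples m (A (u ! i))"
        using q by (auto simp: Relp_def srel_def)
      ultimately show "map (\<lambda>r. r ! j) rs ! i \<in> A (u ! i)"
        using \<open>j < m\<close> by (auto simp: tuples_def)
    qed
    have "length rs = length u"
      using rs by (simp add: in_wprod_iff)
    then have "map (\<lambda>j. (\<lambda>a \<in> wprod A u. f (map (\<lambda>i. a ! \<sigma> i) [0..<length w]))
          (map (\<lambda>r. r ! j) rs)) [0..<m]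
        = map (\<lambda>j. f (map (\<lambda>r. r ! j) ?rs)) [0..<m]"
      using col mm by (auto simp: minor_map_def intro!: arg_cong[where f = f])
    moreover have "map (\<lambda>j. f (map (\<lambda>r. r ! j) ?rs)) [0..<m] \<in> R' s"
      using pres minor_map_wprod[OF mm rs] unfolding preserves.simps by (rule bspec)
    ultimately show ?thesis
      by (simp only:)
  qed
  then show ?thesis
    by simp
qed

lemma minion_mPol:
  assumes "Q \<subseteq> Relp S A"
  shows "minion S A (mPol S A Q)"
  unfolding minion_def
proof (intro conjI ballI allI impI)
  show "mPol S A Q \<subseteq> Op S A"
    by (auto simp: mPol_def)
next
  fix f u \<sigma>
  assume f: "f \<in> mPol S A Q" and mm: "minor_map S (fst (decl f)) u \<sigma>"
  obtain w s g where [simp]: "f = (w, s, g)"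
    by (cases f) auto
  have "preserves (minor A u \<sigma> f) q" if "q \<in> Q" for q
  proof -
    obtain m R R' where "q = (m, R, R')"
      by (cases q) auto
    moreover have "preserves f q" "q \<in> Relp S A"
      using f that assms by (auto simp: mPol_def)
    ultimately show ?thesis
      using mm preserves_minor[of m R R' S A w s g u \<sigma>] by (simp only: decl.simps fst_conv \<open>f = (w, s, g)\<close>)
  qed
  then show "minor A u \<sigma> f \<in> mPol S A Q"
    using f mm minor_in_Op[of w s g S A u \<sigma>] by (auto simp: mPol_def)
qed

lemma in_spow_iff: "x \<in> spow A I s \<longleftrightarrow> x \<in> I \<rightarrow>\<^sub>E A s"
  by (simp add: spow_def)

lemma wprod_spow_coordinate:
  assumes "x \<in> wprod (spow A I) w" "i \<in> I"
  shows "map (\<lambda>g. g i) x \<in> wprod A w"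
  using assms by (auto simp: in_wprod_iff in_spow_iff)

lemma opow_in_Op:
  assumes "(w, s, f) \<in> Op S A"
  shows "opow A I (w, s, f) \<in> Op S (spow A I)"
  using assms wprod_spow_coordinate[of _ A I w] by (auto simp: in_Op_iff in_spow_iff)

lemma reflection_wprod:
  assumes "reflection S C B h h'" "w \<in> lists S" "b \<in> wprod B w"
  shows "map2 h w b \<in> wprod C w"
  using assms(3)
proof (rule wprod_map2)
  fix t x assume "t \<in> set w" "x \<in> B t"
  then show "h t x \<in> C t"
    using assms(1) set_word_subset_supp[OF assms(2,3)] by (auto simp: reflection_def)
qed

lemma reflect_op_in_Op:
  assumes refl: "reflection S C B h h'" and f: "(w, s, f) \<in> Op S C"
    and reas: "reasonable B w s"
  shows "reflect_op B h h' (w, s, f) \<in> Op S B"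
proof -
  have "h' s (f (map2 h w b)) \<in> B s" if b: "b \<in> wprod B w" for b
  proof -
    have "s \<in> supp S B"
      using reas f b by (auto simp: reasonable_def supp_def in_Op_iff)
    moreover have "f (map2 h w b) \<in> C s"
      using reflection_wprod[OF refl _ b] f by (auto simp: in_Op_iff)
    ultimately show ?thesis
      using refl by (auto simp: reflection_def)
  qed
  then show ?thesis
    using f by (auto simp: in_Op_iff)
qed

text \<open>
  Here and in the next lemma both sides rearrange the arguments in the same way; what has to be
  checked is that the argument tuples stay inside the domains of the extensional maps.
\<close>

lemma opow_minor:
  assumes "minor_map S w u \<sigma>"
  shows "opow A I (minor A u \<sigma> (w, s, f)) = minor (spow A I) u \<sigma> (opow A I (w, s, f))"
proof -
  have "(\<lambda>i\<in>I. (\<lambda>a\<in>wprod A u. f (map (\<lambda>j. a ! \<sigma> j) [0..<length w])) (map (\<lambda>g. g i) x))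
      = (\<lambda>y\<in>wprod (spow A I) w. \<lambda>i\<in>I. f (map (\<lambda>g. g i) y)) (map (\<lambda>j. x ! \<sigma> j) [0..<length w])"
    if x: "x \<in> wprod (spow A I) u" for x
  proof -
    have "map (\<lambda>j. map (\<lambda>g. g i) x ! \<sigma> j) [0..<length w]
        = map (\<lambda>g. g i) (map (\<lambda>j. x ! \<sigma> j) [0..<length w])" for i
      using x assms by (auto simp: in_wprod_iff minor_map_def)
    then show ?thesis
      using minor_map_wprod[OF assms x] wprod_spow_coordinate[OF x]
      by (auto intro!: restrict_ext simp del: map_map)
  qed
  then show ?thesis
    by (auto intro!: restrict_ext)
qed

lemma reflect_op_minor:
  assumes refl: "reflection S C B h h'" and mm: "minor_map S w u \<sigma>"
  shows "reflect_op B h h' (minor C u \<sigma> (w, s, f)) = minor B u \<sigma> (reflect_op B h h' (w, s, f))"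
proof -
  have "(\<lambda>a\<in>wprod C u. f (map (\<lambda>i. a ! \<sigma> i) [0..<length w])) (map2 h u b)
      = f (map2 h w (map (\<lambda>i. b ! \<sigma> i) [0..<length w]))" if b: "b \<in> wprod B u" for b
  proof -
    have "map (\<lambda>i. map2 h u b ! \<sigma> i) [0..<length w] = map2 h w (map (\<lambda>i. b ! \<sigma> i) [0..<length w])"
      using b mm by (auto simp: in_wprod_iff minor_map_def intro!: nth_equalityI)
    then show ?thesis
      using reflection_wprod[OF refl _ b] mm by (simp add: minor_map_def)
  qed
  then show ?thesis
    using minor_map_wprod[OF mm, of _ B] by (auto intro!: restrict_ext)
qed

section \<open>Extensions of reflections of powers\<close>

text \<open>
  The witnesses of \<open>M2 \<in> E R P M1\<close>: a single power of \<open>M1\<close> and a reflection that carries it into \<open>M2\<close>.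
\<close>

definition power_reflects_into ::
    "'s set \<Rightarrow> ('s \<Rightarrow> 'a set) \<Rightarrow> ('s, 'a) sop set \<Rightarrow> ('s \<Rightarrow> 'b set) \<Rightarrow> ('s, 'b) sop set \<Rightarrow>
      'i set \<Rightarrow> ('s \<Rightarrow> 'b \<Rightarrow> 'i \<Rightarrow> 'a) \<Rightarrow> ('s \<Rightarrow> ('i \<Rightarrow> 'a) \<Rightarrow> 'b) \<Rightarrow> bool" where
  "power_reflects_into S A M1 B M2 I h h' \<longleftrightarrow>
     reflection S (spow A I) B h h' \<and>
     (\<forall>(w, s, f) \<in> M1. reasonable B w s \<and> reflect_op B h h' (opow A I (w, s, f)) \<in> M2)"

lemma in_extensions_iff:
  "(B, M) \<in> extensions S \<F> \<longleftrightarrow> (\<exists>F. (B, F) \<in> \<F> \<and> F \<subseteq> M \<and> M \<subseteq> Op S B)"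
  by (auto simp: extensions_def)

lemma in_reflections_iff:
  "(B, G) \<in> reflections S \<F> \<longleftrightarrow> (\<exists>C F h h'. (C, F) \<in> \<F> \<and> reflection S C B h h' \<and>
     (\<forall>(w, s, f) \<in> F. reasonable B w s) \<and> G = reflect_op B h h' ` F)"
  unfolding reflections_def mem_Collect_eq prod.inject by (rule iffI; elim exE conjE; hypsubst; blast)

lemma power_reflects_into_iff:
  "power_reflects_into S A M1 B M2 I h h' \<longleftrightarrow> reflection S (spow A I) B h h' \<and>
     (\<forall>(w, s, f) \<in> opow A I ` M1. reasonable B w s) \<and>
     reflect_op B h h' ` opow A I ` M1 \<subseteq> M2"
  by (force simp: power_reflects_into_def)

text \<open>
  The predicate on the index set lets this serve both for all powers and for the finite powers.
\<close>

lemma in_extensions_reflections_iff: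
  assumes "M2 \<subseteq> Op S B"
  shows "(B, M2) \<in> extensions S (reflections S {(spow A I, opow A I ` M1) | I. P I})
    \<longleftrightarrow> (\<exists>I h h'. P I \<and> power_reflects_into S A M1 B M2 I h h')"
  unfolding in_extensions_iff in_reflections_iff power_reflects_into_iff
  using assms by (simp only: mem_Collect_eq prod.inject) metis

lemma minion_hom_if_power_reflects_into:
  assumes refl: "power_reflects_into S A M1 B M2 I h h'"
    and M1: "minion S A M1" and M2: "minion S B M2"
  shows "minion_hom S A M1 B M2 (\<lambda>f. reflect_op B h h' (opow A I f))"
  unfolding minion_hom_def
proof (intro conjI M1 M2 ballI allI impI)
  show "(\<lambda>f. reflect_op B h h' (opow A I f)) \<in> M1 \<rightarrow> M2"
    using refl by (auto simp: power_reflects_into_def)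
  show "decl (reflect_op B h h' (opow A I f)) = decl f" for f
    by (cases f) auto
next
  fix f u \<sigma>
  assume f: "f \<in> M1" and mm: "minor_map S (fst (decl f)) u \<sigma>"
  obtain w s g where [simp]: "f = (w, s, g)"
    by (cases f) auto
  have mm: "minor_map S w u \<sigma>"
    using mm by simp
  have "reflection S (spow A I) B h h'"
    using refl by (simp add: power_reflects_into_def)
  from reflect_op_minor[OF this mm, where s = s] opow_minor[OF mm, where A = A and I = I and s = s and f = g]
  show "minor B u \<sigma> (reflect_op B h h' (opow A I f))
      = reflect_op B h h' (opow A I (minor A u \<sigma> f))"
    by (metis \<open>f = (w, s, g)\<close> opow.simps)
qed

section \<open>The free reflection of a power\<close>

text \<open>
  The values at sorts outside \<open>supp S B\<close> are left arbitrary. This only adds redundant coordinates to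
  the power.
\<close>

definition sorted_maps :: "'s set \<Rightarrow> ('s \<Rightarrow> 'b set) \<Rightarrow> ('s \<Rightarrow> 'a set) \<Rightarrow> ('s \<Rightarrow> 'b \<Rightarrow> 'a) set" where
  "sorted_maps S B A = {\<phi>. \<forall>t \<in> supp S B. \<phi> t \<in> B t \<rightarrow> A t}"

text \<open>
  The hypothesis says that \<open>f\<close> at \<open>b\<close> and \<open>f'\<close> at \<open>b'\<close> generate the same element of the free power.
  Both operations are made into operations of declaration \<open>(w @ w', s)\<close> by sending each argument to a
  chosen position that carries the same sort and the same element of \<open>B\<close>. A tuple of arguments
  \<open>a\<close> for these minors matters only at the chosen positions, and there it is the image of \<open>b @ b'\<close>
  under a sorted map \<open>\<phi>\<close>; hence the minors are equal, and so are their images under \<open>l\<close>, which are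
  then evaluated at \<open>b @ b'\<close>.
\<close>

lemma hom_value_determined:
  assumes hom: "minion_hom S A M1 B M2 l" and supp: "supp S B \<subseteq> supp S A"
    and f: "(w, s, f) \<in> M1" and f': "(w', s, f') \<in> M1"
    and b: "b \<in> wprod B w" and b': "b' \<in> wprod B w'"
    and l: "l (w, s, f) = (w, s, g)" and l': "l (w', s, f') = (w', s, g')"
    and eq: "\<And>\<phi>. \<phi> \<in> sorted_maps S B A \<Longrightarrow> f (map2 \<phi> w b) = f' (map2 \<phi> w' b')"
  shows "g b = g' b'"
proof -
  define v d where "v = w @ w'" and "d = b @ b'"
  have len: "length b = length w" "length b' = length w'"
    using b b' by (auto simp: in_wprod_iff)
  have "(w, s, f) \<in> Op S A" "(w', s, f') \<in> Op S A"
    using hom f f' by (auto simp: minion_hom_def minion_def)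
  then have wS: "w \<in> lists S" "w' \<in> lists S"
    by (auto simp: in_Op_iff)
  have d: "d \<in> wprod B v"
    using b b' by (auto simp: in_wprod_iff v_def d_def nth_append)
  have vS: "v \<in> lists S"
    using wS by (simp add: v_def)
  define pos where "pos t x = (SOME i. i < length v \<and> v ! i = t \<and> d ! i = x)" for t x
  have pos: "pos (v ! i) (d ! i) < length v \<and> v ! pos (v ! i) (d ! i) = v ! i \<and>
      d ! pos (v ! i) (d ! i) = d ! i" if "i < length v" for i
    unfolding pos_def by (rule someI[of _ i]) (use that in auto)
  have pos1: "pos (w ! i) (b ! i) < length v \<and> v ! pos (w ! i) (b ! i) = w ! i \<and>
      d ! pos (w ! i) (b ! i) = b ! i" if "i < length w" for i
    using pos[of i] that len by (simp add: v_def d_def nth_append)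
  have pos2: "pos (w' ! i) (b' ! i) < length v \<and> v ! pos (w' ! i) (b' ! i) = w' ! i \<and>
      d ! pos (w' ! i) (b' ! i) = b' ! i" if "i < length w'" for i
    using pos[of "length w + i"] that len by (simp add: v_def d_def nth_append)
  define \<sigma> \<sigma>' where "\<sigma> i = pos (w ! i) (b ! i)" and "\<sigma>' i = pos (w' ! i) (b' ! i)" for i
  have mm: "minor_map S w v \<sigma>" "minor_map S w' v \<sigma>'"
    using vS pos1 pos2 by (auto simp: minor_map_def \<sigma>_def \<sigma>'_def)
  have "f (map (\<lambda>i. a ! \<sigma> i) [0..<length w]) = f' (map (\<lambda>i. a ! \<sigma>' i) [0..<length w'])"
    if a: "a \<in> wprod A v" for a
  proof -
    (* Nonemptiness of A t for t in the support of B is needed for the values that a leaves open. *)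
    define \<phi> where "\<phi> t x = (if pos t x < length v \<and> v ! pos t x = t then a ! pos t x
        else (SOME y. y \<in> A t))" for t x
    have "\<phi> t x \<in> A t" if "t \<in> supp S B" for t x
    proof -
      have "(SOME y. y \<in> A t) \<in> A t"
        using that supp by (auto simp: supp_def intro: some_in_eq[THEN iffD2])
      then show ?thesis
        using a by (auto simp: \<phi>_def in_wprod_iff)
    qed
    then have "\<phi> \<in> sorted_maps S B A"
      by (auto simp: sorted_maps_def)
    from eq[OF this] have "f (map2 \<phi> w b) = f' (map2 \<phi> w' b')" .
    moreover have "map2 \<phi> w b = map (\<lambda>i. a ! \<sigma> i) [0..<length w]"
      using pos1 len by (auto simp: \<phi>_def \<sigma>_def intro!: nth_equalityI)
    moreover have "map2 \<phi> w' b' = map (\<lambda>i. a ! \<sigma>' i) [0..<length w']"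
      using pos2 len by (auto simp: \<phi>_def \<sigma>'_def intro!: nth_equalityI)
    ultimately show ?thesis
      by simp
  qed
  then have "minor A v \<sigma> (w, s, f) = minor A v \<sigma>' (w', s, f')"
    by (auto intro!: restrict_ext)
  moreover have "minor B v \<sigma> (l (w, s, f)) = l (minor A v \<sigma> (w, s, f))"
    using hom f mm(1) unfolding minion_hom_def by fastforce
  moreover have "minor B v \<sigma>' (l (w', s, f')) = l (minor A v \<sigma>' (w', s, f'))"
    using hom f' mm(2) unfolding minion_hom_def by fastforce
  ultimately have "minor B v \<sigma> (w, s, g) = minor B v \<sigma>' (w', s, g')"
    using l l' by simp
  then have "(\<lambda>a \<in> wprod B v. g (map (\<lambda>i. a ! \<sigma> i) [0..<length w])) d
      = (\<lambda>a \<in> wprod B v. g' (map (\<lambda>i. a ! \<sigma>' i) [0..<length w'])) d"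
    by simp
  moreover have "map (\<lambda>i. d ! \<sigma> i) [0..<length w] = b"
    using pos1 len by (auto simp: \<sigma>_def intro!: nth_equalityI)
  moreover have "map (\<lambda>i. d ! \<sigma>' i) [0..<length w'] = b'"
    using pos2 len by (auto simp: \<sigma>'_def intro!: nth_equalityI)
  ultimately show ?thesis
    using d by simp
qed

text \<open>
  The index set is a copy of the set of all sorted maps, moved by \<open>\<iota>\<close> into a type that may be larger.
  In the proof, \<open>h t x\<close> is the evaluation at \<open>x\<close>, and \<open>V s y\<close> is the set of values that \<open>h'\<close> must take
  at \<open>y\<close> if the reflected power of each \<open>f\<close> is to be \<open>l f\<close>; it has at most one element by the
  preceding lemma. Where it is empty, \<open>h'\<close> is unconstrained.
\<close>

lemma power_reflects_into_if_minion_hom: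
  fixes A :: "'s \<Rightarrow> 'a set" and B :: "'s \<Rightarrow> 'b set" and \<iota> :: "('s \<Rightarrow> 'b \<Rightarrow> 'a) \<Rightarrow> 'i"
  assumes hom: "minion_hom S A M1 B M2 l" and supp: "supp S B \<subseteq> supp S A"
    and inj: "inj \<iota>"
  shows "\<exists>h h'. power_reflects_into S A M1 B M2 (\<iota> ` sorted_maps S B A) h h'"
proof -
  define I where "I = \<iota> ` sorted_maps S B A"
  define h where "h t x = (\<lambda>i \<in> I. inv \<iota> i t x)" for t x
  define V where "V s y = {g b | w f g b. (w, s, f) \<in> M1 \<and> l (w, s, f) = (w, s, g) \<and>
      b \<in> wprod B w \<and> (\<lambda>i \<in> I. f (map (\<lambda>x. x i) (map2 h w b))) = y}" for s y
  define h' where "h' s y = (if V s y = {} then SOME c. c \<in> B s else SOME c. c \<in> V s y)" for s y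
  have M1: "M1 \<subseteq> Op S A" and M2: "M2 \<subseteq> Op S B" and lM: "l \<in> M1 \<rightarrow> M2"
    using hom by (auto simp: minion_hom_def minion_def)
  have coord: "map (\<lambda>x. x (\<iota> \<phi>)) (map2 h w b) = map2 \<phi> w b"
    if "\<phi> \<in> sorted_maps S B A" for \<phi> w b
    using that inj by (auto simp: h_def I_def)
  have V_sub: "V s y \<subseteq> B s" for s y
  proof
    fix c assume "c \<in> V s y"
    then obtain w f g b where "(w, s, f) \<in> M1" "l (w, s, f) = (w, s, g)" "b \<in> wprod B w" "c = g b"
      by (auto simp: V_def)
    then show "c \<in> B s"
      using lM M2 by (fastforce simp: in_Op_iff)
  qed
  have V_unique: "c = c'" if c: "c \<in> V s y" and c': "c' \<in> V s y" for s y c c'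
  proof -
    obtain w f g b where 1: "(w, s, f) \<in> M1" "l (w, s, f) = (w, s, g)" "b \<in> wprod B w" "c = g b"
      and y: "(\<lambda>i \<in> I. f (map (\<lambda>x. x i) (map2 h w b))) = y"
      using c by (auto simp: V_def)
    obtain w' f' g' b' where 2: "(w', s, f') \<in> M1" "l (w', s, f') = (w', s, g')"
      "b' \<in> wprod B w'" "c' = g' b'"
      and y': "(\<lambda>i \<in> I. f' (map (\<lambda>x. x i) (map2 h w' b'))) = y"
      using c' by (auto simp: V_def)
    have "f (map2 \<phi> w b) = f' (map2 \<phi> w' b')" if \<phi>: "\<phi> \<in> sorted_maps S B A" for \<phi>
    proof -
      have "\<iota> \<phi> \<in> I"
        using \<phi> by (simp add: I_def)
      then have "f (map (\<lambda>x. x (\<iota> \<phi>)) (map2 h w b)) = f' (map (\<lambda>x. x (\<iota> \<phi>)) (map2 h w' b'))"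
        using fun_cong[OF y, of "\<iota> \<phi>"] fun_cong[OF y', of "\<iota> \<phi>"] by simp
      then show ?thesis
        unfolding coord[OF \<phi>] .
    qed
    from hom_value_determined[OF hom supp 1(1) 2(1) 1(3) 2(3) 1(2) 2(2) this] show ?thesis
      using 1 2 by simp
  qed
  have refl: "reflection S (spow A I) B h h'"
    unfolding reflection_def
  proof (intro ballI conjI Pi_I)
    fix t x assume "t \<in> supp S B" "x \<in> B t"
    then show "h t x \<in> spow A I t"
      using inj by (auto simp: h_def in_spow_iff I_def sorted_maps_def Pi_iff)
  next
    fix t y assume "t \<in> supp S B"
    then have "(SOME c. c \<in> B t) \<in> B t"
      by (auto simp: supp_def some_in_eq)
    moreover have "V t y \<noteq> {} \<Longrightarrow> (SOME c. c \<in> V t y) \<in> B t"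
      using V_sub by (metis some_in_eq subsetD)
    ultimately show "h' t y \<in> B t"
      by (simp add: h'_def)
  qed
  have "reasonable B w s \<and> reflect_op B h h' (opow A I (w, s, f)) \<in> M2"
    if f: "(w, s, f) \<in> M1" for w s f
  proof -
    have "decl (l (w, s, f)) = (w, s)"
      using hom f by (fastforce simp: minion_hom_def)
    then obtain g where g: "l (w, s, f) = (w, s, g)"
      by (metis decl.elims fst_conv snd_conv)
    have gM: "(w, s, g) \<in> M2"
      using g lM f by force
    then have gO: "(w, s, g) \<in> Op S B" and fO: "(w, s, f) \<in> Op S A"
      using f M1 M2 by auto
    have "reasonable B w s"
      using gO by (auto simp: in_Op_iff reasonable_def)
    moreover have "reflect_op B h h' (opow A I (w, s, f)) = (w, s, g)"
    proof -
      have "h' s (snd (snd (opow A I (w, s, f))) (map2 h w b)) = g b" if b: "b \<in> wprod B w" for b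
      proof -
        let ?y = "\<lambda>i \<in> I. f (map (\<lambda>x. x i) (map2 h w b))"
        have "w \<in> lists S"
          using fO by (simp add: in_Op_iff)
        then have "snd (snd (opow A I (w, s, f))) (map2 h w b) = ?y"
          using reflection_wprod[OF refl _ b] by simp
        moreover have mem: "g b \<in> V s ?y"
          using f g b by (auto simp: V_def)
        then have "V s ?y = {g b}"
          using V_unique[OF mem] by blast
        then have "h' s ?y = g b"
          by (simp add: h'_def)
        ultimately show ?thesis
          by simp
      qed
      then show ?thesis
        using gO by (auto simp: in_Op_iff intro!: extensionalityI[where A = "wprod B w"])
    qed
    ultimately show ?thesis
      using gM by simp
  qed
  with refl have "power_reflects_into S A M1 B M2 I h h'"
    by (auto simp: power_reflects_into_def)
  then show ?thesis
    unfolding I_def by blast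
qed

section \<open>Flattening and coreflection of relation pairs\<close>

lemma length_flat_tuple [simp]: "length (flat_tuple k xs) = length xs * k"
  by (induction xs) (auto simp: flat_tuple_def)

text \<open>
  The successor occurs because list positions count from 0, while the coordinates of a \<open>k\<close>-th power
  are \<open>1, \<dots>, k\<close>.
\<close>

lemma nth_flat_tuple:
  assumes "j < length xs * k"
  shows "flat_tuple k xs ! j = (xs ! (j div k)) (Suc (j mod k))"
  using assms
proof (induction xs arbitrary: j)
  case (Cons x xs)
  have flat: "flat_tuple k (x # xs) = map x [1..<Suc k] @ flat_tuple k xs"
    by (simp add: flat_tuple_def del: upt_Suc)
  show ?case
  proof (cases "j < k")
    case True
    then show ?thesis
      unfolding flat by (simp add: nth_append del: upt_Suc)
  next
    case False
    moreover from this have "k > 0"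
      using Cons.prems by (cases k) auto
    ultimately have "(j - k) div k = j div k - 1" "(j - k) mod k = j mod k" "0 < j div k"
      by (auto simp: le_div_geq le_mod_geq div_greater_zero_iff)
    then show ?thesis
      using Cons False unfolding flat by (simp add: nth_append nth_Cons' del: upt_Suc)
  qed
qed simp

text \<open>
  The common length of the lists makes this true also for \<open>k = 0\<close>, when every flattened tuple is empty
  but the power has only one element.
\<close>

lemma inj_on_flat_tuple: "inj_on (flat_tuple k) (tuples m (spow A {1..k} s))"
proof (rule inj_onI, rule nth_equalityI)
  fix xs ys
  assume xs: "xs \<in> tuples m (spow A {1..k} s)" and ys: "ys \<in> tuples m (spow A {1..k} s)"
    and eq: "flat_tuple k xs = flat_tuple k ys"
  show len: "length xs = length ys"
    using xs ys by (simp add: tuples_def)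
  fix j assume j: "j < length xs"
  then have mem: "xs ! j \<in> {1..k} \<rightarrow>\<^sub>E A s" "ys ! j \<in> {1..k} \<rightarrow>\<^sub>E A s"
    using xs ys len by (auto simp: tuples_def spow_def subset_iff)
  have "(xs ! j) i = (ys ! j) i" if i: "i \<in> {1..k}" for i
  proof -
    let ?n = "j * k + (i - 1)"
    obtain n where "i = Suc n" "n < k"
      using i by (cases i) auto
    then have div: "?n div k = j" and mod: "Suc (?n mod k) = i"
      by auto
    moreover have "?n < length xs * k"
    proof -
      have "?n < Suc j * k"
        using i by auto
      also have "Suc j * k \<le> length xs * k"
        using j by (intro mult_le_mono1) simp
      finally show ?thesis .
    qed
    ultimately show ?thesis
      using nth_flat_tuple[of ?n xs k] nth_flat_tuple[of ?n ys k] eq len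
      unfolding div mod by simp
  qed
  then show "xs ! j = ys ! j"
    using mem by (auto intro: PiE_ext)
qed

lemma flat_tuple_in_tuples:
  assumes "xs \<in> tuples m (spow A {1..k} s)"
  shows "flat_tuple k xs \<in> tuples (m * k) (A s)"
proof -
  have "set (flat_tuple k xs) \<subseteq> A s"
    using assms
    by (fastforce simp: tuples_def flat_tuple_def spow_def PiE_iff subset_iff simp del: upt_Suc)
  then show ?thesis
    using assms by (simp add: tuples_def)
qed

lemma flat_in_Relp:
  assumes "q \<in> Relp S (spow A {1..k})"
  shows "flat k q \<in> Relp S A"
proof -
  obtain m R R' where [simp]: "q = (m, R, R')"
    by (cases q) auto
  show ?thesis
    using assms by (fastforce simp: Relp_def srel_def intro: flat_tuple_in_tuples)
qed

text \<open>
  Row \<open>j\<close> of the flattened matrix is coordinate \<open>j mod k + 1\<close> of row \<open>j div k\<close> of the original one, and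
  the power acts on each coordinate separately.
\<close>

lemma flat_tuple_apply:
  assumes xs: "xs \<in> wprod (\<lambda>t. tuples m (spow A {1..k} t)) w"
  shows "map (\<lambda>j. f (map (\<lambda>r. r ! j) (map (flat_tuple k) xs))) [0..<m * k]
    = flat_tuple k (map (\<lambda>j. snd (snd (opow A {1..k} (w, s, f))) (map (\<lambda>r. r ! j) xs)) [0..<m])"
    (is "?l = flat_tuple k ?a")
proof (rule nth_equalityI)
  show "length ?l = length (flat_tuple k ?a)"
    by simp
  fix j assume "j < length ?l"
  then have j: "j < m * k"
    by simp
  then have k: "k > 0"
    by (cases k) auto
  have jm: "j div k < m"
    using j by (simp add: less_mult_imp_div_less)
  have len: "length x = m" if "x \<in> set xs" for x
    using that xs by (auto simp: in_wprod_iff tuples_def in_set_conv_nth)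
  have col: "map (\<lambda>r. r ! (j div k)) xs \<in> wprod (spow A {1..k}) w"
    using xs jm by (auto simp: in_wprod_iff tuples_def subset_iff)
  have "map (\<lambda>r. r ! j) (map (flat_tuple k) xs)
      = map (\<lambda>g. g (Suc (j mod k))) (map (\<lambda>r. r ! (j div k)) xs)"
    using len j by (simp add: nth_flat_tuple)
  moreover have "Suc (j mod k) \<in> {1..k}"
    using k by (simp add: Suc_leI)
  ultimately show "?l ! j = flat_tuple k ?a ! j"
    using j jm col by (simp add: nth_flat_tuple del: map_map)
qed

text \<open>
  Application of \<open>f\<close> commutes with flattening, and flattening is injective, so no tuple outside
  \<open>R'\<close> can be flattened to a member of the flattened \<open>R'\<close>.
\<close>

lemma preserves_flat_iff:
  assumes f: "(w, s, f) \<in> Op S A" and q: "q \<in> Relp S (spow A {1..k})"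
  shows "preserves (w, s, f) (flat k q) \<longleftrightarrow> preserves (opow A {1..k} (w, s, f)) q"
proof -
  obtain m R R' where [simp]: "q = (m, R, R')"
    by (cases q) auto
  let ?C = "spow A {1..k}"
  define F where "F = snd (snd (opow A {1..k} (w, s, f)))"
  have opow: "opow A {1..k} (w, s, f) = (w, s, F)"
    by (simp add: F_def)
  have FO: "(w, s, F) \<in> Op S ?C"
    using opow_in_Op[OF f, of "{1..k}"] unfolding opow .
  have R: "R t \<subseteq> tuples m (?C t)" "R' t \<subseteq> tuples m (?C t)" if "t \<in> S" for t
    using q that by (auto simp: Relp_def srel_def)
  have wS: "w \<in> lists S" and sS: "s \<in> S"
    using f by (auto simp: in_Op_iff)
  have key: "map (\<lambda>j. f (map (\<lambda>r. r ! j) (map (flat_tuple k) xs))) [0..<m * k] \<in> flat_tuple k ` R' s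
      \<longleftrightarrow> map (\<lambda>j. F (map (\<lambda>r. r ! j) xs)) [0..<m] \<in> R' s" if xs: "xs \<in> wprod R w" for xs
  proof -
    have xs': "xs \<in> wprod (\<lambda>t. tuples m (?C t)) w"
      using xs R wS by (auto simp: in_wprod_iff subset_iff in_lists_conv_set)
    have "map (\<lambda>r. r ! j) xs \<in> wprod ?C w" if "j < m" for j
      using xs' that by (auto simp: in_wprod_iff tuples_def subset_iff)
    then have "map (\<lambda>j. F (map (\<lambda>r. r ! j) xs)) [0..<m] \<in> tuples m (?C s)"
      using FO by (auto simp: tuples_def in_Op_iff)
    from inj_on_image_mem_iff[OF inj_on_flat_tuple this R(2)[OF sS]] show ?thesis
      unfolding flat_tuple_apply[OF xs', of f s] F_def[symmetric] .
  qed
  have "wprod (\<lambda>t. flat_tuple k ` R t) w = map (flat_tuple k) ` wprod R w" (is "?l = ?r")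
  proof
    show "?r \<subseteq> ?l"
      by (auto simp: in_wprod_iff)
    show "?l \<subseteq> ?r"
    proof
      fix ys assume ys: "ys \<in> ?l"
      then have "\<forall>i. \<exists>x. i < length w \<longrightarrow> x \<in> R (w ! i) \<and> ys ! i = flat_tuple k x"
        by (auto simp: in_wprod_iff)
      then obtain x where x: "\<And>i. i < length w \<Longrightarrow> x i \<in> R (w ! i) \<and> ys ! i = flat_tuple k (x i)"
        by metis
      then have "map x [0..<length w] \<in> wprod R w" "ys = map (flat_tuple k) (map x [0..<length w])"
        using ys by (auto simp: in_wprod_iff intro!: nth_equalityI)
      then show "ys \<in> ?r"
        by blast
    qed
  qed
  then show ?thesis
    unfolding opow using key by simp
qed

lemma coreflect_in_Relp:
  assumes refl: "reflection S C B h h'" and q: "q \<in> Relp S B"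
  shows "coreflect S C B h h' q \<in> Relp S C"
proof -
  obtain m T T' where [simp]: "q = (m, T, T')"
    by (cases q) auto
  have "map (h t) x \<in> tuples m (C t)" if "t \<in> supp S B" "x \<in> T t" for t x
  proof -
    have "x \<in> tuples m (B t)" "h t \<in> B t \<rightarrow> C t"
      using that q refl by (auto simp: Relp_def srel_def supp_def reflection_def)
    then show ?thesis
      by (auto simp: tuples_def)
  qed
  then show ?thesis
    by (auto simp: Relp_def srel_def supp_def)
qed

text \<open>
  On both sides the entries of the tuple under \<open>h'\<close> are \<open>h'(f(h(t\<^sub>1), \<dots>, h(t\<^sub>n)))\<close>, with \<open>t\<^sub>i\<close> ranging
  over the entries of the \<open>i\<close>-th tuple in \<open>ts\<close>.
\<close>

lemma coreflect_apply:
  assumes refl: "reflection S C B h h'" and f: "(w, s, f) \<in> Op S C"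
    and wB: "set w \<subseteq> supp S B" and sB: "s \<in> supp S B"
    and q: "(m, T, T') \<in> Relp S B" and ts: "ts \<in> wprod T w"
  shows "map (\<lambda>j. snd (snd (reflect_op B h h' (w, s, f))) (map (\<lambda>r. r ! j) ts)) [0..<m] \<in> T' s
    \<longleftrightarrow> map (\<lambda>j. f (map (\<lambda>r. r ! j) (map2 (\<lambda>t. map (h t)) w ts))) [0..<m]
      \<in> {a \<in> tuples m (C s). map (h' s) a \<in> T' s}"
proof -
  have wS: "w \<in> lists S"
    using f by (simp add: in_Op_iff)
  have T: "T t \<subseteq> tuples m (B t)" if "t \<in> S" for t
    using q that by (auto simp: Relp_def srel_def)
  have "ts ! i \<in> tuples m (B (w ! i))" if "i < length w" for i
    using ts T[of "w ! i"] wS that by (auto simp: in_wprod_iff subset_iff in_lists_conv_set)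
  then have ts': "ts ! i \<in> tuples m (B (w ! i))" "length ts = length w" if "i < length w" for i
    using that ts by (auto simp: in_wprod_iff)
  have lts: "length ts = length w"
    using ts by (simp add: in_wprod_iff)
  have col: "map (\<lambda>r. r ! j) ts \<in> wprod B w" if "j < m" for j
    using ts' lts that by (fastforce simp: in_wprod_iff tuples_def)
  have colh: "map (\<lambda>r. r ! j) (map2 (\<lambda>t. map (h t)) w ts) = map2 h w (map (\<lambda>r. r ! j) ts)"
    if "j < m" for j
    using ts' lts that by (intro nth_equalityI) (auto simp: tuples_def)
  have "f (map2 h w (map (\<lambda>r. r ! j) ts)) \<in> C s" if "j < m" for j
    using reflection_wprod[OF refl wS col[OF that]] f by (auto simp: in_Op_iff)
  then have "map (\<lambda>j. f (map (\<lambda>r. r ! j) (map2 (\<lambda>t. map (h t)) w ts))) [0..<m] \<in> tuples m (C s)"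
    using colh by (auto simp: tuples_def simp del: map_map)
  moreover have "map (h' s) (map (\<lambda>j. f (map (\<lambda>r. r ! j) (map2 (\<lambda>t. map (h t)) w ts))) [0..<m])
      = map (\<lambda>j. snd (snd (reflect_op B h h' (w, s, f))) (map (\<lambda>r. r ! j) ts)) [0..<m]"
    using col colh by (auto simp del: map_map simp: map_map[of "h' s"])
  ultimately show ?thesis
    by (simp only: mem_Collect_eq simp_thms)
qed

lemma wprod_coreflect:
  assumes wB: "set w \<subseteq> supp S B"
  shows "wprod (\<lambda>t. if t \<in> supp S B then map (h t) ` T t else {}) w
    = map2 (\<lambda>t. map (h t)) w ` wprod T w" (is "?l = ?r")
proof
  have supp: "w ! i \<in> supp S B" if "i < length w" for i
    using wB that by (auto simp: subset_iff)
  show "?r \<subseteq> ?l"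
    using supp by (auto simp: in_wprod_iff)
  show "?l \<subseteq> ?r"
  proof
    fix ys assume ys: "ys \<in> ?l"
    then have "\<forall>i. \<exists>x. i < length w \<longrightarrow> x \<in> T (w ! i) \<and> ys ! i = map (h (w ! i)) x"
      using supp by (auto simp: in_wprod_iff image_iff Bex_def)
    then obtain x where x: "\<And>i. i < length w \<Longrightarrow> x i \<in> T (w ! i) \<and> ys ! i = map (h (w ! i)) (x i)"
      by metis
    then have "map x [0..<length w] \<in> wprod T w"
      "ys = map2 (\<lambda>t. map (h t)) w (map x [0..<length w])"
      using ys by (auto simp: in_wprod_iff intro!: nth_equalityI)
    then show "ys \<in> ?r"
      by blast
  qed
qed

text \<open>
  The hypotheses on \<open>w\<close> and \<open>s\<close> keep the components that coreflection replaces by empty relations out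
  of the declaration.
\<close>

lemma preserves_coreflect_iff:
  assumes refl: "reflection S C B h h'" and f: "(w, s, f) \<in> Op S C"
    and wB: "set w \<subseteq> supp S B" and sB: "s \<in> supp S B"
    and q: "q \<in> Relp S B"
  shows "preserves (w, s, f) (coreflect S C B h h' q) \<longleftrightarrow>
    preserves (reflect_op B h h' (w, s, f)) q"
proof -
  obtain m T T' where [simp]: "q = (m, T, T')"
    by (cases q) auto
  define g where "g = snd (snd (reflect_op B h h' (w, s, f)))"
  have g: "reflect_op B h h' (w, s, f) = (w, s, g)"
    by (simp add: g_def)
  have "map (\<lambda>j. g (map (\<lambda>r. r ! j) ts)) [0..<m] \<in> T' s
    \<longleftrightarrow> map (\<lambda>j. f (map (\<lambda>r. r ! j) (map2 (\<lambda>t. map (h t)) w ts))) [0..<m]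
      \<in> {a \<in> tuples m (C s). map (h' s) a \<in> T' s}" if "ts \<in> wprod T w" for ts
    using coreflect_apply[OF refl f wB sB _ that, of m T'] q unfolding g_def by simp
  then show ?thesis
    unfolding g using sB by (simp add: wprod_coreflect[OF wB] del: map_map)
qed

section \<open>Finite powers\<close>

text \<open>
  The 0-th power has a single element, \<open>\<lambda>_. undefined\<close>, so its reflections are constant. A constant
  map \<open>h'\<close> with the same value does the same on the first power, where \<open>h\<close> may be chosen arbitrarily;
  it exists because \<open>A\<close> is nonempty where \<open>B\<close> is.
\<close>

lemma power_reflects_into_1_if_0:
  fixes A :: "'s \<Rightarrow> 'a set" and B :: "'s \<Rightarrow> 'b set"
  assumes supp: "supp S B \<subseteq> supp S A" and M1: "M1 \<subseteq> Op S A"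
    and refl: "power_reflects_into S A M1 B M2 {1..0::nat} h h'"
  shows "\<exists>h h'. power_reflects_into S A M1 B M2 {1..1::nat} h h'"
proof -
  (* Any element of A t serves as the value of h1, since h1' does not look at it. *)
  define h1 where "h1 t (x :: 'b) = (\<lambda>i \<in> {1..1::nat}. SOME a. a \<in> A t)" for t x
  define h1' where "h1' t (y :: nat \<Rightarrow> 'a) = h' t (\<lambda>_. undefined)" for t y
  have r0: "reflection S (spow A {1..0::nat}) B h h'"
    using refl by (simp add: power_reflects_into_def)
  have r1: "reflection S (spow A {1..1::nat}) B h1 h1'"
    using supp r0 by (auto simp: reflection_def spow_def h1_def h1'_def supp_def some_in_eq)
  have "reflect_op B h1 h1' (opow A {1..1::nat} f) = reflect_op B h h' (opow A {1..0::nat} f)"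
    if "f \<in> M1" for f
  proof -
    obtain w s g where [simp]: "f = (w, s, g)"
      by (cases f) auto
    have "(w, s, g) \<in> Op S A"
      using that M1 by auto
    then have "w \<in> lists S"
      by (simp add: in_Op_iff)
    then have "map2 h w b \<in> wprod (spow A {1..0::nat}) w" if "b \<in> wprod B w" for b
      using reflection_wprod[OF r0 _ that] by simp
    then show ?thesis
      by (auto simp: h1'_def restrict_def)
  qed
  then have "power_reflects_into S A M1 B M2 {1..1::nat} h1 h1'"
    using refl r1 by (auto simp: power_reflects_into_def)
  then show ?thesis
    by blast
qed

text \<open>
  Both Galois identities are read from operations to pairs. If an argument sort has an empty component
  in \<open>B\<close>, the coreflected relation at that sort is empty and preservation is vacuous; otherwise the
  component of the result sort is nonempty, because the declaration is reasonable.
\<close>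

lemma flat_coreflect_subset_mInv:
  assumes refl: "power_reflects_into S A M1 B (mPol S B QB) {1..k::nat} h h'"
    and M1: "M1 \<subseteq> Op S A" and QB: "QB \<subseteq> Relp S B"
  shows "flat k ` coreflect S (spow A {1..k}) B h h' ` QB \<subseteq> mInv S A M1"
proof -
  let ?C = "spow A {1..k}"
  have r: "reflection S ?C B h h'"
    using refl by (simp add: power_reflects_into_def)
  have "flat k (coreflect S ?C B h h' q) \<in> mInv S A M1" if qQ: "q \<in> QB" for q
  proof -
    have q: "q \<in> Relp S B"
      using QB qQ by auto
    note cq = coreflect_in_Relp[OF r q]
    have "preserves f (flat k (coreflect S ?C B h h' q))" if fM: "f \<in> M1" for f
    proof -
      obtain w s g where [simp]: "f = (w, s, g)"
        by (cases f) auto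
      have fO: "(w, s, g) \<in> Op S A"
        using fM M1 by auto
      have reas: "reasonable B w s" and pol: "reflect_op B h h' (opow A {1..k} f) \<in> mPol S B QB"
        using refl fM by (auto simp: power_reflects_into_def)
      obtain G where G: "opow A {1..k} (w, s, g) = (w, s, G)"
        by simp
      have GO: "(w, s, G) \<in> Op S ?C"
        using opow_in_Op[OF fO, of "{1..k}"] G by simp
      have "preserves (w, s, G) (coreflect S ?C B h h' q)"
      proof (cases "set w \<subseteq> supp S B")
        case True
        then have "s \<in> supp S B"
          using reas fO wprod_eq_empty_iff[of B w] by (auto simp: reasonable_def supp_def in_Op_iff)
        with True preserves_coreflect_iff[OF r GO _ _ q] pol qQ G show ?thesis
          by (auto simp: mPol_def)
      next
        case False
        obtain m T T' where "q = (m, T, T')"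
          by (cases q) auto
        moreover have "wprod (\<lambda>t. if t \<in> supp S B then map (h t) ` T t else {}) w = {}" for T
          using False by (auto simp: wprod_eq_empty_iff)
        ultimately show ?thesis
          by simp
      qed
      then show ?thesis
        using preserves_flat_iff[OF fO cq] G by simp
    qed
    then show ?thesis
      using flat_in_Relp[OF cq] by (simp add: mInv_def)
  qed
  then show ?thesis
    by auto
qed

text \<open>
  Both Galois identities are read from pairs to operations, which covers the declarations with
  nonempty components only. For the others, \<open>compat\<close> provides a member of \<open>M2\<close> of the same
  declaration; its existence forces the domain to be empty, so it is the reflected operation.
\<close>

lemma power_reflects_into_if_flat_coreflect_subset_mInv:
  assumes r: "reflection S (spow A {1..k}) B h h'"
    and sub: "flat k ` coreflect S (spow A {1..k}) B h h' ` QB \<subseteq> mInv S A M1"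
    and M1: "M1 \<subseteq> Op S A" and QB: "QB \<subseteq> Relp S B"
    and compat: "empty_sorts_compatible B M1 (mPol S B QB)"
  shows "power_reflects_into S A M1 B (mPol S B QB) {1..k::nat} h h'"
proof -
  let ?C = "spow A {1..k}"
  have "reasonable B w s \<and> reflect_op B h h' (opow A {1..k} (w, s, f)) \<in> mPol S B QB"
    if f: "(w, s, f) \<in> M1" for w s f
  proof -
    have fO: "(w, s, f) \<in> Op S A"
      using f M1 by auto
    obtain F where F: "opow A {1..k} (w, s, f) = (w, s, F)"
      by simp
    have FO: "(w, s, F) \<in> Op S ?C"
      using opow_in_Op[OF fO, of "{1..k}"] F by simp
    show ?thesis
    proof (cases "\<exists>t \<in> insert s (set w). B t = {}")
      case True
      then obtain g where g: "(w, s, g) \<in> mPol S B QB"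
        using compat f unfolding empty_sorts_compatible_def by fast
      then have gO: "g \<in> extensional (wprod B w)" "\<forall>b \<in> wprod B w. g b \<in> B s"
        by (auto simp: mPol_def in_Op_iff)
      then have "wprod B w = {}"
        using True wprod_eq_empty_iff[of B w] by auto
      then have "reflect_op B h h' (opow A {1..k} (w, s, f)) = (w, s, g)" "reasonable B w s"
        using gO by (auto simp: reasonable_def)
      then show ?thesis
        using g by simp
    next
      case False
      then have B: "set w \<subseteq> supp S B" "s \<in> supp S B" "reasonable B w s"
        using fO by (auto simp: supp_def in_Op_iff reasonable_def)
      have "preserves (reflect_op B h h' (w, s, F)) q" if "q \<in> QB" for q
      proof -
        have q: "q \<in> Relp S B"
          using QB that by auto
        have "preserves (w, s, f) (flat k (coreflect S ?C B h h' q))"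
          using sub that f by (auto simp: mInv_def)
        then have "preserves (w, s, F) (coreflect S ?C B h h' q)"
          using preserves_flat_iff[OF fO coreflect_in_Relp[OF r q]] F by simp
        then show ?thesis
          using preserves_coreflect_iff[OF r FO B(1,2) q] by simp
      qed
      then show ?thesis
        using B reflect_op_in_Op[OF r FO] unfolding F by (auto simp: mPol_def)
    qed
  qed
  with r show ?thesis
    by (auto simp: power_reflects_into_def)
qed

section \<open>The characterization\<close>

theorem theorem4p13:
  fixes S :: "'s set"
    and A :: "'s \<Rightarrow> 'a set" and B :: "'s \<Rightarrow> 'b set"
    and QA :: "('s, 'a) rpair set" and QB :: "('s, 'b) rpair set"
    and M1 :: "('s, 'a) sop set" and M2 :: "('s, 'b) sop set"
  assumes "supp S B \<subseteq> supp S A"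
    and "QA \<subseteq> Relp S A" and "QB \<subseteq> Relp S B"
    and "M1 = mPol S A QA" and "M2 = mPol S B QB"
  shows
    "((B, M2) \<in> extensions S (reflections S (powers TYPE('i + ('s \<Rightarrow> 'b \<Rightarrow> 'a)) A M1))
        \<longleftrightarrow> (\<exists>l. minion_hom S A M1 B M2 l))
     \<and>
     ((\<forall>s \<in> S. finite (A s) \<and> finite (B s)) \<longrightarrow>
        (let cond_i = ((B, M2) \<in> extensions S (reflections S (fin_powers A M1)));
             cond_ii = (\<exists>k \<ge> 1. \<exists>h h'. reflection S (spow A {1..k}) B h h' \<and>
                          flat k ` coreflect S (spow A {1..k}) B h h' ` QB \<subseteq> minor_closure S A QA)
         in (cond_i \<longrightarrow> cond_ii) \<and>
            (empty_sorts_compatible B M1 M2 \<longrightarrow> (cond_i \<longleftrightarrow> cond_ii))))"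
proof -
  have min1: "minion S A M1" and min2: "minion S B M2"
    using minion_mPol assms by auto
  then have M1: "M1 \<subseteq> Op S A" and M2: "M2 \<subseteq> Op S B"
    by (auto simp: minion_def)
  have "(B, M2) \<in> extensions S (reflections S (powers TYPE('i + ('s \<Rightarrow> 'b \<Rightarrow> 'a)) A M1))
      \<longleftrightarrow> (\<exists>(I :: ('i + ('s \<Rightarrow> 'b \<Rightarrow> 'a)) set) h h'. power_reflects_into S A M1 B M2 I h h')"
    unfolding powers_def using in_extensions_reflections_iff[OF M2, where P = "\<lambda>_. True"] by simp
  also have "\<dots> \<longleftrightarrow> (\<exists>l. minion_hom S A M1 B M2 l)"
    using minion_hom_if_power_reflects_into[OF _ min1 min2]
      power_reflects_into_if_minion_hom[OF _ assms(1) inj_Inr]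
    by blast
  finally have a: "(B, M2) \<in> extensions S (reflections S (powers TYPE('i + ('s \<Rightarrow> 'b \<Rightarrow> 'a)) A M1))
      \<longleftrightarrow> (\<exists>l. minion_hom S A M1 B M2 l)" .
  define i where "i \<longleftrightarrow> (B, M2) \<in> extensions S (reflections S (fin_powers A M1))"
  define ii where "ii \<longleftrightarrow> (\<exists>k \<ge> 1. \<exists>h h'. reflection S (spow A {1..k}) B h h' \<and>
      flat k ` coreflect S (spow A {1..k}) B h h' ` QB \<subseteq> minor_closure S A QA)"
  (* The set-builder form that in_extensions_reflections_iff expects. *)
  have "fin_powers A M1 = {(spow A I, opow A I ` M1) | I. \<exists>k. I = {1..k}}"
    by (auto simp: fin_powers_def)
  then have i_iff: "i \<longleftrightarrow> (\<exists>k h h'. power_reflects_into S A M1 B M2 {1..k::nat} h h')"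
    unfolding i_def by (simp only: in_extensions_reflections_iff[OF M2]) auto
  have cl: "minor_closure S A QA = mInv S A M1"
    by (simp add: minor_closure_def assms)
  have "ii" if cond_i: "i"
  proof -
    obtain k h h' where "power_reflects_into S A M1 B M2 {1..k::nat} h h'"
      using cond_i i_iff by blast
    then obtain k h h' where k: "k \<ge> 1" and p: "power_reflects_into S A M1 B M2 {1..k::nat} h h'"
      using power_reflects_into_1_if_0[OF assms(1) M1] by (metis le_refl less_one linorder_not_le)
    have "reflection S (spow A {1..k}) B h h'"
      using p by (simp add: power_reflects_into_def)
    moreover have "flat k ` coreflect S (spow A {1..k}) B h h' ` QB \<subseteq> mInv S A M1"
      using flat_coreflect_subset_mInv[OF p[unfolded assms(5)] M1 assms(3)] .
    ultimately show ?thesis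
      unfolding ii_def cl using k by blast
  qed
  moreover have "i" if cond_ii: "ii" and compat: "empty_sorts_compatible B M1 M2"
  proof -
    obtain k h h' where "reflection S (spow A {1..k}) B h h'"
      and "flat k ` coreflect S (spow A {1..k}) B h h' ` QB \<subseteq> mInv S A M1"
      using cond_ii unfolding ii_def cl by blast
    from power_reflects_into_if_flat_coreflect_subset_mInv[OF this M1 assms(3) compat[unfolded assms(5)]]
    show ?thesis
      unfolding i_iff assms(5) by blast
  qed
  ultimately show ?thesis
    using a unfolding Let_def i_def[symmetric] ii_def[symmetric] by blast
qed

end
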